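(* Let $m\in\mathbb{N}$ and $P\subseteq H_m$. Then $P$ is piecewise syndetic if and only if there are a thick $T\subseteq H_m$ and a syndetic $S\subseteq H_m$ with $P=S\cap T$.
   Context: Let $L$ be a relational language and $\mathbf{K}$ a Fraïssé structure, i.e. a countably infinite $L$-structure that is ultrahomogeneous (every isomorphism between finite substructures of $\mathbf{K}$ extends to an automorphism of $\mathbf{K}$). Let $G=\mathrm{Aut}(\mathbf{K})$. Fix an exhaustion $\mathbf{K}=\bigcup_n\mathbf{A}_n$ by finite substructures with $\mathbf{A}_m\subseteq\mathbf{A}_n$ for $m\le n$, and let $H_n=\mathrm{Emb}(\mathbf{A}_n,\mathbf{K})$ be the set of embeddings of $\mathbf{A}_n$ into $\mathbf{K}$. $G$ acts on the right on $2^{H_m}$ (product topology) by $(\chi_A\cdot g)(f)=\chi_A(g\circ f)$ for $A\subseteq H_m$, $g\in G$, $f\in H_m$. A set $T\subseteq H_m$ is thick if $\chi_{H_m}\in\overline{\chi_T\cdot G}$; $S\subseteq H_m$ is syndetic if $\chi_\emptyset\notin\overline{\chi_S\cdot G}$; $P\subseteq H_m$ is piecewise syndetic if there is a syndetic $S\subseteq H_m$ with $\chi_S\in\overline{\chi_P\cdot G}$. *)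

theory Defs
  imports "HOL-Analysis.Abstract_Topology" "HOL-Analysis.Function_Topology"
    "HOL-Library.Countable_Set"
begin

text \<open>The set of relation symbols is explicit, so that the empty language (and any infinite
  one) is covered. Relations of a structure are sets of tuples, and tuples are lists.\<close>

record 'r language =
  symbols :: "'r set"
  arity :: "'r \<Rightarrow> nat"

record ('r, 'a) struct =
  univ :: "'a set"
  rel :: "'r \<Rightarrow> 'a list set"

definition tuples :: "nat \<Rightarrow> 'a set \<Rightarrow> 'a list set" where
  "tuples k X = {xs. length xs = k \<and> set xs \<subseteq> X}"

definition is_structure :: "'r language \<Rightarrow> ('r, 'a) struct \<Rightarrow> bool" where
  "is_structure L M \<longleftrightarrow> (\<forall>R \<in> symbols L. rel M R \<subseteq> tuples (arity L R) (univ M))"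

definition substructure ::
    "'r language \<Rightarrow> ('r, 'a) struct \<Rightarrow> ('r, 'a) struct \<Rightarrow> bool" where
  "substructure L A M \<longleftrightarrow> univ A \<subseteq> univ M \<and>
     (\<forall>R \<in> symbols L. rel A R = rel M R \<inter> tuples (arity L R) (univ A))"

text \<open>Maps between structures are extensional (undefined off the domain), so that distinct
  elements of the following sets are distinct as maps.\<close>

definition Emb ::
    "'r language \<Rightarrow> ('r, 'a) struct \<Rightarrow> ('r, 'b) struct \<Rightarrow> ('a \<Rightarrow> 'b) set" where
  "Emb L A B = {f \<in> univ A \<rightarrow>\<^sub>E univ B. inj_on f (univ A) \<and>
     (\<forall>R \<in> symbols L. \<forall>xs \<in> tuples (arity L R) (univ A).
        xs \<in> rel A R \<longleftrightarrow> map f xs \<in> rel B R)}"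

definition Iso ::
    "'r language \<Rightarrow> ('r, 'a) struct \<Rightarrow> ('r, 'b) struct \<Rightarrow> ('a \<Rightarrow> 'b) set" where
  "Iso L A B = {f \<in> Emb L A B. f ` univ A = univ B}"

definition Aut :: "'r language \<Rightarrow> ('r, 'a) struct \<Rightarrow> ('a \<Rightarrow> 'a) set" where
  "Aut L M = Iso L M M"

definition ultrahomogeneous :: "'r language \<Rightarrow> ('r, 'a) struct \<Rightarrow> bool" where
  "ultrahomogeneous L M \<longleftrightarrow>
     (\<forall>A B. \<forall>f \<in> Iso L A B.
        substructure L A M \<and> finite (univ A) \<and> substructure L B M \<and> finite (univ B) \<longrightarrow>
        (\<exists>g \<in> Aut L M. \<forall>x \<in> univ A. g x = f x))"

definition fraisse_structure :: "'r language \<Rightarrow> ('r, 'a) struct \<Rightarrow> bool" where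
  "fraisse_structure L K \<longleftrightarrow> is_structure L K \<and>
     countable (univ K) \<and> infinite (univ K) \<and> ultrahomogeneous L K"

definition exhaustion ::
    "'r language \<Rightarrow> ('r, 'a) struct \<Rightarrow> (nat \<Rightarrow> ('r, 'a) struct) \<Rightarrow> bool" where
  "exhaustion L K A \<longleftrightarrow>
     (\<forall>n. substructure L (A n) K \<and> finite (univ (A n))) \<and>
     (\<forall>m n. m \<le> n \<longrightarrow> substructure L (A m) (A n)) \<and>
     univ K = (\<Union>n. univ (A n))"

text \<open>The space \<open>2\<close> to the power \<open>H\<close>, with \<open>bool\<close> as the discrete two-point space; its points
  are the functions that are extensional on \<open>H\<close>.\<close>

definition cantor_space :: "'h set \<Rightarrow> ('h \<Rightarrow> bool) topology" where
  "cantor_space H = product_topology (\<lambda>_. discrete_topology UNIV) H"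

definition chi :: "'h set \<Rightarrow> 'h set \<Rightarrow> 'h \<Rightarrow> bool" where
  "chi H X = restrict (\<lambda>f. f \<in> X) H"

text \<open>In the following definitions \<open>H\<close> is \<open>Emb L A K\<close>; the right action of \<open>g\<close> sends
  \<open>\<phi>\<close> to \<open>f \<mapsto> \<phi> (g \<circ> f)\<close>, the composition being taken on the domain \<open>univ A\<close>.\<close>

definition act :: "'r language \<Rightarrow> ('r, 'a) struct \<Rightarrow> ('r, 'a) struct \<Rightarrow>
    (('a \<Rightarrow> 'a) \<Rightarrow> bool) \<Rightarrow> ('a \<Rightarrow> 'a) \<Rightarrow> (('a \<Rightarrow> 'a) \<Rightarrow> bool)" where
  "act L K A \<phi> g = restrict (\<lambda>f. \<phi> (compose (univ A) g f)) (Emb L A K)"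

definition orbit_closure :: "'r language \<Rightarrow> ('r, 'a) struct \<Rightarrow> ('r, 'a) struct \<Rightarrow>
    (('a \<Rightarrow> 'a) \<Rightarrow> bool) \<Rightarrow> (('a \<Rightarrow> 'a) \<Rightarrow> bool) set" where
  "orbit_closure L K A \<phi> = cantor_space (Emb L A K) closure_of (act L K A \<phi> ` Aut L K)"

definition thick ::
    "'r language \<Rightarrow> ('r, 'a) struct \<Rightarrow> ('r, 'a) struct \<Rightarrow> ('a \<Rightarrow> 'a) set \<Rightarrow> bool" where
  "thick L K A T \<longleftrightarrow> T \<subseteq> Emb L A K \<and>
     chi (Emb L A K) (Emb L A K) \<in> orbit_closure L K A (chi (Emb L A K) T)"

definition syndetic ::
    "'r language \<Rightarrow> ('r, 'a) struct \<Rightarrow> ('r, 'a) struct \<Rightarrow> ('a \<Rightarrow> 'a) set \<Rightarrow> bool" where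
  "syndetic L K A S \<longleftrightarrow> S \<subseteq> Emb L A K \<and>
     chi (Emb L A K) {} \<notin> orbit_closure L K A (chi (Emb L A K) S)"

definition piecewise_syndetic ::
    "'r language \<Rightarrow> ('r, 'a) struct \<Rightarrow> ('r, 'a) struct \<Rightarrow> ('a \<Rightarrow> 'a) set \<Rightarrow> bool" where
  "piecewise_syndetic L K A P \<longleftrightarrow> P \<subseteq> Emb L A K \<and>
     (\<exists>S. syndetic L K A S \<and>
        chi (Emb L A K) S \<in> orbit_closure L K A (chi (Emb L A K) P))"

end

theory Submission
  imports Defs "HOL-Analysis.T1_Spaces"
begin

text \<open>
  Write \<open>H\<close> for the set of embeddings and identify subsets of \<open>H\<close> with points of the compact
  space \<open>2\<close> to the power \<open>H\<close>, on which the automorphism group acts continuously. In terms of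
  finite sets \<open>F \<subseteq> H\<close>: a set is thick if it contains a translate of every \<open>F\<close>, and syndetic if
  some \<open>F\<close> has no translate disjoint from it. All the sets in the orbit closure of a syndetic
  set are syndetic (\<open>syndetic_in_orbit_closure\<close>).

  Let \<open>T\<close> be thick and \<open>S\<close> syndetic. Along automorphisms that move larger and larger finite
  sets into \<open>T\<close>, the translates of \<open>T\<close> converge to \<open>H\<close>, and by compactness the translates of
  \<open>S\<close> accumulate at some \<open>S'\<close>. Then \<open>S \<inter> T\<close> accumulates at \<open>S'\<close> as well, and \<open>S'\<close> is
  syndetic (\<open>thick_cluster_set\<close>).

  Conversely, let \<open>P\<close> be piecewise syndetic, so that its orbit closure contains a syndetic set
  and hence the orbit closure \<open>M\<close> of that set. It does not suffice to take for \<open>T\<close> the union of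
  \<open>P\<close> with finite pieces of \<open>H\<close> on which \<open>P\<close> looks syndetic: the gaps of \<open>P\<close> in different
  pieces may combine to a thick set. What is needed is a single syndetic set \<open>S0\<close> that
  agrees with \<open>P\<close> on translates of arbitrary finite sets: then \<open>P \<union> (H - S0)\<close> is thick,
  \<open>P \<union> S0\<close> is syndetic, and they intersect in \<open>P\<close>. The Auslander--Ellis theorem supplies it:
  some point \<open>S0\<close> of \<open>M\<close> is proximal to \<open>P\<close>, which means that the translates of \<open>P\<close> and
  \<open>S0\<close> under the same automorphisms have a common limit. That theorem
  (\<open>proximal_point_in_invariant_set\<close>) is proved with an idempotent of the enveloping semigroup.
\<close>

section \<open>Idempotents in compact semigroups\<close>

lemma compact_space_Inter_nonempty:
  assumes "compact_space Z" and "\<And>C. C \<in> \<C> \<Longrightarrow> closedin Z C"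
    and "\<And>\<F>. \<lbrakk>finite \<F>; \<F> \<subseteq> \<C>\<rbrakk> \<Longrightarrow> \<Inter>\<F> \<noteq> {}"
  shows "\<Inter>\<C> \<noteq> {}"
  using assms(1)[unfolded compact_space_fip, THEN spec, THEN mp, OF conjI] assms(2,3) by metis

definition closed_subsemigroup :: "'z topology \<Rightarrow> ('z \<Rightarrow> 'z \<Rightarrow> 'z) \<Rightarrow> 'z set \<Rightarrow> bool" where
  "closed_subsemigroup Z mul A \<longleftrightarrow> closedin Z A \<and> A \<noteq> {} \<and> (\<forall>p\<in>A. \<forall>q\<in>A. mul p q \<in> A)"

text \<open>Zorn's lemma applies because, by compactness, the intersection of a chain of nonempty
  closed sets is nonempty.\<close>

lemma minimal_closed_subsemigroup:
  fixes Z :: "'z topology"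
  assumes "compact_space Z" and "closed_subsemigroup Z mul J"
  obtains A where "closed_subsemigroup Z mul A" "A \<subseteq> J"
    and "\<And>B. \<lbrakk>closed_subsemigroup Z mul B; B \<subseteq> A\<rbrakk> \<Longrightarrow> B = A"
proof -
  define \<S> where "\<S> = {A. closed_subsemigroup Z mul A \<and> A \<subseteq> J}"
  define R where "R = (\<lambda>A B :: 'z set. B \<subseteq> A)"
  have "J \<in> \<S>"
    using assms by (auto simp: \<S>_def)
  have "\<exists>A\<in>\<S>. \<forall>B\<in>\<S>. R A B \<longrightarrow> B = A"
  proof (rule predicate_Zorn)
    show "partial_order_on \<S> (relation_of R \<S>)"
      by (rule partial_order_on_relation_ofI) (auto simp: R_def)
  next
    fix \<C> assume chain: "\<C> \<in> Chains (relation_of R \<S>)"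
    then have sub: "\<C> \<subseteq> \<S>"
      by (rule Chains_relation_of)
    have total: "A \<subseteq> B \<or> B \<subseteq> A" if "A \<in> \<C>" "B \<in> \<C>" for A B
      using chain that by (auto simp: Chains_def relation_of_def R_def)
    show "\<exists>U\<in>\<S>. \<forall>A\<in>\<C>. R A U"
    proof (cases "\<C> = {}")
      case True
      with \<open>J \<in> \<S>\<close> show ?thesis by auto
    next
      case False
      have least: "\<Inter>\<F> \<in> \<F>" if "finite \<F>" "\<F> \<noteq> {}" "\<F> \<subseteq> \<C>" for \<F>
        using that
      proof (induction rule: finite_ne_induct)
        case (insert A \<F>)
        then have "\<Inter>\<F> \<in> \<F>" "A \<in> \<C>" "\<F> \<subseteq> \<C>"
          by auto
        then have "A \<subseteq> \<Inter>\<F> \<or> \<Inter>\<F> \<subseteq> A"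
          using total by blast
        then have "\<Inter>(insert A \<F>) = A \<or> \<Inter>(insert A \<F>) = \<Inter>\<F>"
          by auto
        with \<open>\<Inter>\<F> \<in> \<F>\<close> show ?case
          by auto
      qed simp
      have fip: "\<Inter>\<F> \<noteq> {}" if "finite \<F>" "\<F> \<subseteq> \<C>" for \<F>
        using least[OF that(1) _ that(2)] that sub by (cases "\<F> = {}") (auto simp: \<S>_def closed_subsemigroup_def)
      have closed: "closedin Z A" if "A \<in> \<C>" for A
        using sub that by (auto simp: \<S>_def closed_subsemigroup_def)
      have "\<Inter>\<C> \<noteq> {}"
        using \<open>compact_space Z\<close> closed fip by (rule compact_space_Inter_nonempty)
      moreover have "closedin Z (\<Inter>\<C>)"
        using closed False by blast
      ultimately have "\<Inter>\<C> \<in> \<S>"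
        using sub False unfolding \<S>_def closed_subsemigroup_def by blast
      then show ?thesis
        by (auto simp: R_def)
    qed
  qed
  then obtain A where "A \<in> \<S>" and "\<And>B. B \<in> \<S> \<Longrightarrow> B \<subseteq> A \<Longrightarrow> B = A"
    by (auto simp: R_def)
  then show ?thesis
    using that[of A] by (auto simp: \<S>_def)
qed

text \<open>The Ellis--Numakura lemma: multiplication need only be continuous in its left factor,
  because in a minimal closed subsemigroup \<open>A\<close> the set \<open>A u\<close> and the stabiliser of \<open>u\<close> are the
  image of \<open>A\<close> and the preimage of \<open>{u}\<close> under right multiplication by \<open>u\<close>.\<close>

lemma idempotent_in_compact_semigroup:
  fixes Z :: "'z topology" and mul :: "'z \<Rightarrow> 'z \<Rightarrow> 'z"
  assumes "compact_space Z" and "Hausdorff_space Z" and "closedin Z J" and "J \<noteq> {}"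
    and J: "\<And>p q. \<lbrakk>p \<in> J; q \<in> J\<rbrakk> \<Longrightarrow> mul p q \<in> J"
    and assoc: "\<And>p q r. \<lbrakk>p \<in> J; q \<in> J; r \<in> J\<rbrakk> \<Longrightarrow> mul (mul p q) r = mul p (mul q r)"
    and cont: "\<And>q. q \<in> J \<Longrightarrow> continuous_map Z Z (\<lambda>p. mul p q)"
  obtains u where "u \<in> J" "mul u u = u"
proof -
  have "closed_subsemigroup Z mul J"
    using assms(3,4) J by (simp add: closed_subsemigroup_def)
  then obtain A where "closed_subsemigroup Z mul A" "A \<subseteq> J"
    and min: "\<And>B. \<lbrakk>closed_subsemigroup Z mul B; B \<subseteq> A\<rbrakk> \<Longrightarrow> B = A"
    using minimal_closed_subsemigroup[OF assms(1)] by metis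
  then have A: "closedin Z A" "A \<noteq> {}" "A \<subseteq> J" and mulA: "\<And>p q. \<lbrakk>p \<in> A; q \<in> A\<rbrakk> \<Longrightarrow> mul p q \<in> A"
    by (auto simp: closed_subsemigroup_def)
  obtain u where u: "u \<in> A"
    using A by auto
  then have "u \<in> J" and "u \<in> topspace Z"
    using A closedin_subset by auto
  have mulA_assoc: "mul (mul p q) r = mul p (mul q r)" if "p \<in> A" "q \<in> A" "r \<in> A" for p q r
    using assoc A(3) that by blast
  \<comment> \<open>The left ideal generated by \<open>u\<close> is all of \<open>A\<close>, so \<open>u\<close> is a left multiple of itself.\<close>
  have Au: "(\<lambda>p. mul p u) ` A = A"
  proof (rule min)
    have "closedin Z ((\<lambda>p. mul p u) ` A)"
      using \<open>u \<in> J\<close> A assms(1,2) cont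
      by (meson closedin_compact_space compactin_imp_closedin image_compactin)
    moreover have "mul (mul p u) (mul q u) = mul (mul p (mul u q)) u" if "p \<in> A" "q \<in> A" for p q
      using that u mulA mulA_assoc by simp
    ultimately show "closed_subsemigroup Z mul ((\<lambda>p. mul p u) ` A)"
      using A(2) u mulA by (auto simp: closed_subsemigroup_def)
    show "(\<lambda>p. mul p u) ` A \<subseteq> A"
      using u mulA by auto
  qed
  obtain p where "p \<in> A" "mul p u = u"
    using u Au by (metis (no_types, lifting) imageE)
  \<comment> \<open>So the stabiliser of \<open>u\<close> is a nonempty closed subsemigroup; by minimality it contains \<open>u\<close>.\<close>
  have "{p \<in> A. mul p u = u} = A"
  proof (rule min)
    have "closedin Z {u}"
      using assms(2) \<open>u \<in> topspace Z\<close> by (rule closedin_Hausdorff_singleton)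
    then have "closedin Z {p \<in> A. mul p u = u}"
      using closedin_continuous_map_preimage_gen[OF cont[OF \<open>u \<in> J\<close>] A(1), of "{u}"] by simp
    then show "closed_subsemigroup Z mul {p \<in> A. mul p u = u}"
      using \<open>p \<in> A\<close> \<open>mul p u = u\<close> u mulA mulA_assoc by (auto simp: closed_subsemigroup_def)
  qed auto
  with u \<open>u \<in> J\<close> that show ?thesis by auto
qed

section \<open>The Auslander--Ellis theorem\<close>

text \<open>The closure \<open>E\<close> of \<open>\<G>\<close> in the space of all self-maps of \<open>X\<close>, with the topology of
  pointwise convergence, is a compact semigroup under composition (the enveloping semigroup).
  Its elements that send \<open>x\<close> into \<open>M\<close> form a closed subsemigroup, so there is an idempotent
  \<open>u\<close> among them. With \<open>y = u x\<close> one has \<open>u x = y = u y\<close>, and \<open>u\<close> is a pointwise limit of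
  elements of \<open>\<G>\<close>.\<close>

lemma proximal_point_in_invariant_set:
  fixes X :: "'x topology" and \<G> :: "('x \<Rightarrow> 'x) set"
  assumes "compact_space X" and "Hausdorff_space X"
    and cont: "\<And>g. g \<in> \<G> \<Longrightarrow> continuous_map X X g"
    and comp: "\<And>g h. \<lbrakk>g \<in> \<G>; h \<in> \<G>\<rbrakk> \<Longrightarrow> \<exists>k\<in>\<G>. \<forall>x\<in>topspace X. k x = g (h x)"
    and x: "x \<in> topspace X"
    and M: "closedin X M" "\<And>g y. \<lbrakk>g \<in> \<G>; y \<in> M\<rbrakk> \<Longrightarrow> g y \<in> M"
    and meet: "M \<inter> X closure_of ((\<lambda>g. g x) ` \<G>) \<noteq> {}"
  obtains y where "y \<in> M"
    "\<And>U. \<lbrakk>openin X U; y \<in> U\<rbrakk> \<Longrightarrow> \<exists>g\<in>\<G>. g x \<in> U \<and> g y \<in> U"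
proof -
  let ?X = "topspace X"
  define Z where "Z = product_topology (\<lambda>_. X) ?X"
  define \<G>' where "\<G>' = (\<lambda>g. restrict g ?X) ` \<G>"
  define E where "E = Z closure_of \<G>'"
  have Z: "compact_space Z" "Hausdorff_space Z"
    using assms(1,2) by (auto simp: Z_def compact_space_product_topology Hausdorff_space_product_topology)
  have topZ: "topspace Z = ?X \<rightarrow>\<^sub>E ?X"
    by (simp add: Z_def)
  have gX: "g y \<in> ?X" if "g \<in> \<G>" "y \<in> ?X" for g y
    using continuous_map_image_subset_topspace[OF cont] that by blast
  have G'Z: "\<G>' \<subseteq> topspace Z"
    using gX by (auto simp: \<G>'_def topZ)
  have "closedin Z E" and EZ: "E \<subseteq> topspace Z"
    by (auto simp: E_def closure_of_subset_topspace)
  have E_apply: "p y \<in> ?X" if "p \<in> E" "y \<in> ?X" for p y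
    using that EZ topZ by auto
  have eval: "continuous_map Z X (\<lambda>p. p y)" if "y \<in> ?X" for y
    using that by (auto simp: Z_def intro: continuous_map_product_projection)
  have E_closure: "p y \<in> X closure_of ((\<lambda>g. g y) ` \<G>)" if "p \<in> E" "y \<in> ?X" for p y
  proof -
    have "(\<lambda>p. p y) ` \<G>' = (\<lambda>g. g y) ` \<G>"
      using that by (auto simp: \<G>'_def image_image)
    with continuous_map_image_closure_subset[OF eval[OF that(2)], of \<G>'] that(1)
    show ?thesis
      unfolding E_def by force
  qed
  have comp_right: "continuous_map Z Z (\<lambda>p. compose ?X p q)" if "q \<in> E" for q
    unfolding Z_def continuous_map_componentwise
    using eval E_apply[OF that] by (auto simp: compose_def Z_def)
  have comp_left: "continuous_map Z Z (\<lambda>q. compose ?X p q)" if p: "p \<in> \<G>'" for p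
  proof -
    obtain g where g: "g \<in> \<G>" "p = restrict g ?X"
      using p by (auto simp: \<G>'_def)
    have "continuous_map X X p"
      using cont[OF g(1)] by (rule continuous_map_eq) (simp add: g)
    then have "continuous_map Z X (\<lambda>q. p (q y))" if "y \<in> ?X" for y
      using continuous_map_compose[OF eval[OF that]] by (simp add: o_def)
    then show ?thesis
      unfolding Z_def continuous_map_componentwise by (auto simp: compose_def Z_def)
  qed
  have G'G': "compose ?X p q \<in> \<G>'" if pq: "p \<in> \<G>'" "q \<in> \<G>'" for p q
  proof -
    obtain g h where gh: "g \<in> \<G>" "p = restrict g ?X" "h \<in> \<G>" "q = restrict h ?X"
      using pq by (auto simp: \<G>'_def)
    obtain k where "k \<in> \<G>" "\<forall>x\<in>?X. k x = g (h x)"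
      using comp[OF gh(1,3)] by blast
    then have "compose ?X p q = restrict k ?X"
      using gh gX by (auto simp: compose_def fun_eq_iff)
    with \<open>k \<in> \<G>\<close> show ?thesis
      by (auto simp: \<G>'_def)
  qed
  have G'E: "compose ?X p q \<in> E" if "p \<in> \<G>'" "q \<in> E" for p q
  proof -
    have "compose ?X p q \<in> Z closure_of (compose ?X p ` \<G>')"
      using continuous_map_image_closure_subset[OF comp_left[OF that(1)], of \<G>'] that(2)
      by (auto simp: E_def)
    also have "\<dots> \<subseteq> E"
      unfolding E_def using G'G' that(1) by (intro closure_of_mono) auto
    finally show ?thesis .
  qed
  \<comment> \<open>Composition with an element of \<open>E\<close> on the left may be discontinuous, so closure of \<open>E\<close>
    under composition is obtained one factor at a time, the right factor first.\<close>
  have EE: "compose ?X p q \<in> E" if "p \<in> E" "q \<in> E" for p q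
  proof -
    have "compose ?X p q \<in> Z closure_of ((\<lambda>p. compose ?X p q) ` \<G>')"
      using continuous_map_image_closure_subset[OF comp_right[OF that(2)], of \<G>'] that(1)
      by (auto simp: E_def)
    also have "\<dots> \<subseteq> E"
      using G'E that(2) \<open>closedin Z E\<close> by (intro closure_of_minimal) auto
    finally show ?thesis .
  qed
  have EM: "p y \<in> M" if "p \<in> E" "y \<in> M" for p y
  proof -
    have "y \<in> ?X"
      using that M(1) closedin_subset by blast
    then show ?thesis
      using E_closure[OF that(1)] closure_of_minimal[OF _ M(1), of "(\<lambda>g. g y) ` \<G>"] M(2) that(2)
      by blast
  qed

  define J where "J = {p \<in> E. p x \<in> M}"
  have "closedin Z J"
    unfolding J_def by (rule closedin_continuous_map_preimage_gen[OF eval[OF x] \<open>closedin Z E\<close> M(1)])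
  have "J \<noteq> {}"
  proof -
    \<comment> \<open>The image of the compact set \<open>E\<close> under evaluation at \<open>x\<close> is closed, so it exhausts the
      orbit closure of \<open>x\<close>.\<close>
    have "closedin X ((\<lambda>p. p x) ` E)"
      using eval[OF x] \<open>closedin Z E\<close> Z(1) assms(2)
      by (meson closedin_compact_space compactin_imp_closedin image_compactin)
    moreover have "(\<lambda>g. g x) ` \<G> \<subseteq> (\<lambda>p. p x) ` E"
    proof -
      have "(\<lambda>g. g x) ` \<G> = (\<lambda>p. p x) ` \<G>'"
        using x by (auto simp: \<G>'_def image_image)
      moreover have "\<G>' \<subseteq> E"
        unfolding E_def using G'Z by (rule closure_of_subset)
      ultimately show ?thesis by auto
    qed
    ultimately have "X closure_of ((\<lambda>g. g x) ` \<G>) \<subseteq> (\<lambda>p. p x) ` E"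
      by (rule closure_of_minimal[rotated])
    with meet show ?thesis
      unfolding J_def by blast
  qed
  obtain u where u: "u \<in> J" "compose ?X u u = u"
  proof (rule idempotent_in_compact_semigroup[where mul = "compose ?X",
        OF Z \<open>closedin Z J\<close> \<open>J \<noteq> {}\<close>])
    show "compose ?X p q \<in> J" if "p \<in> J" "q \<in> J" for p q
      using that EE EM x by (auto simp: J_def compose_def)
    show "compose ?X (compose ?X p q) r = compose ?X p (compose ?X q r)"
      if "p \<in> J" "q \<in> J" "r \<in> J" for p q r
      using that E_apply by (auto simp: J_def compose_def fun_eq_iff)
    show "continuous_map Z Z (\<lambda>p. compose ?X p q)" if "q \<in> J" for q
      using that comp_right by (auto simp: J_def)
  qed
  have "u \<in> E" "u x \<in> M"
    using u(1) by (auto simp: J_def)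
  have uux: "u (u x) = u x"
    using fun_cong[OF u(2), of x] x by (simp add: compose_def)
  show ?thesis
  proof (rule that[OF \<open>u x \<in> M\<close>])
    fix U assume U: "openin X U" "u x \<in> U"
    have "u x \<in> ?X"
      using E_apply \<open>u \<in> E\<close> x by blast
    define W where "W = {p \<in> topspace Z. p x \<in> U} \<inter> {p \<in> topspace Z. p (u x) \<in> U}"
    have "openin Z W"
      unfolding W_def using openin_continuous_map_preimage[OF eval U(1)] x \<open>u x \<in> ?X\<close> by blast
    moreover have "u \<in> W"
      using \<open>u \<in> E\<close> EZ U uux by (auto simp: W_def)
    ultimately obtain p where "p \<in> \<G>'" "p \<in> W"
      using \<open>u \<in> E\<close> unfolding E_def in_closure_of by blast
    then show "\<exists>g\<in>\<G>. g x \<in> U \<and> g (u x) \<in> U"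
      using x \<open>u x \<in> ?X\<close> by (auto simp: \<G>'_def W_def)
  qed
qed

section \<open>The flow of sets of embeddings\<close>

lemma topspace_cantor_space [simp]: "topspace (cantor_space H) = H \<rightarrow>\<^sub>E UNIV"
  by (simp add: cantor_space_def)

lemma compact_cantor_space: "compact_space (cantor_space H)"
  by (simp add: cantor_space_def compact_space_product_topology compact_space_discrete_topology)

lemma Hausdorff_cantor_space: "Hausdorff_space (cantor_space H)"
  by (simp add: cantor_space_def Hausdorff_space_product_topology)

lemma chi_in_cantor_space: "chi H X \<in> H \<rightarrow>\<^sub>E UNIV"
  by (simp add: chi_def)

lemma chi_apply: "f \<in> H \<Longrightarrow> chi H X f \<longleftrightarrow> f \<in> X"
  by (simp add: chi_def)

lemma chi_Collect: "\<psi> \<in> H \<rightarrow>\<^sub>E UNIV \<Longrightarrow> chi H {f \<in> H. \<psi> f} = \<psi>"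
  by (auto simp: chi_def fun_eq_iff PiE_iff extensional_def)

lemma openin_cantor_cylinder:
  assumes "finite F" and "F \<subseteq> H"
  shows "openin (cantor_space H) {\<phi> \<in> H \<rightarrow>\<^sub>E UNIV. \<forall>f\<in>F. \<phi> f = \<psi> f}"
proof -
  have "(\<forall>f\<in>F. \<phi> f = \<psi> f) \<longleftrightarrow> (\<forall>f\<in>H. \<phi> f \<in> (if f \<in> F then {\<psi> f} else UNIV))" for \<phi>
    using assms(2) by auto
  then have "{\<phi> \<in> H \<rightarrow>\<^sub>E UNIV. \<forall>f\<in>F. \<phi> f = \<psi> f} = (\<Pi>\<^sub>E f\<in>H. if f \<in> F then {\<psi> f} else UNIV)"
    unfolding PiE_iff set_eq_iff mem_Collect_eq by (simp add: conj_commute)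
  moreover have "finite {f \<in> H. (if f \<in> F then {\<psi> f} else UNIV) \<noteq> UNIV}"
    using assms(1) by (rule rev_finite_subset) auto
  ultimately show ?thesis
    unfolding cantor_space_def by (simp add: openin_PiE_gen)
qed

text \<open>Basic open sets constrain only finitely many coordinates, so adherence is agreement on
  finite sets. This removes topology from the notions below.\<close>

lemma in_cantor_closure_iff:
  assumes "\<Phi> \<subseteq> H \<rightarrow>\<^sub>E UNIV"
  shows "\<psi> \<in> cantor_space H closure_of \<Phi> \<longleftrightarrow>
     \<psi> \<in> H \<rightarrow>\<^sub>E UNIV \<and> (\<forall>F. finite F \<and> F \<subseteq> H \<longrightarrow> (\<exists>\<phi>\<in>\<Phi>. \<forall>f\<in>F. \<phi> f = \<psi> f))"
    (is "?lhs \<longleftrightarrow> ?top \<and> ?approx")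
proof
  assume L: ?lhs
  show "?top \<and> ?approx"
  proof (intro conjI allI impI)
    show ?top
      using L by (simp add: in_closure_of)
    fix F assume F: "finite F \<and> F \<subseteq> H"
    have "\<psi> \<in> {\<phi> \<in> H \<rightarrow>\<^sub>E UNIV. \<forall>f\<in>F. \<phi> f = \<psi> f}"
      using \<open>?top\<close> by simp
    with L openin_cantor_cylinder[of F H \<psi>] F
    obtain \<phi> where "\<phi> \<in> \<Phi>" "\<phi> \<in> {\<phi> \<in> H \<rightarrow>\<^sub>E UNIV. \<forall>f\<in>F. \<phi> f = \<psi> f}"
      unfolding in_closure_of by meson
    then show "\<exists>\<phi>\<in>\<Phi>. \<forall>f\<in>F. \<phi> f = \<psi> f"
      by auto
  qed
next
  assume R: "?top \<and> ?approx"
  show ?lhs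
    unfolding in_closure_of
  proof (intro conjI allI impI)
    show "\<psi> \<in> topspace (cantor_space H)"
      using R by simp
    fix V assume V: "\<psi> \<in> V \<and> openin (cantor_space H) V"
    then obtain U where U: "finite {f \<in> H. U f \<noteq> (UNIV :: bool set)}" "\<psi> \<in> Pi\<^sub>E H U" "Pi\<^sub>E H U \<subseteq> V"
      unfolding cantor_space_def openin_product_topology_alt by auto
    from U(1) R obtain \<phi> where \<phi>: "\<phi> \<in> \<Phi>" "\<forall>f\<in>{f \<in> H. U f \<noteq> UNIV}. \<phi> f = \<psi> f"
      by (metis (no_types, lifting) mem_Collect_eq subsetI)
    have "\<phi> f \<in> U f" if "f \<in> H" for f
      using \<phi>(2) U(2) that by (cases "U f = UNIV") (auto simp: PiE_iff)
    moreover have "\<phi> \<in> H \<rightarrow>\<^sub>E UNIV"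
      using assms \<phi>(1) by (rule subsetD)
    ultimately have "\<phi> \<in> Pi\<^sub>E H U"
      by (simp add: PiE_iff)
    with U(3) \<phi>(1) show "\<exists>y. y \<in> \<Phi> \<and> y \<in> V"
      by blast
  qed
qed

lemma compose_Emb:
  assumes f: "f \<in> Emb L A B" and g: "g \<in> Emb L B C"
  shows "compose (univ A) g f \<in> Emb L A C"
proof -
  have fB: "f x \<in> univ B" if "x \<in> univ A" for x
    using f that by (auto simp: Emb_def)
  have "inj_on (compose (univ A) g f) (univ A)"
    using f g fB by (auto simp: Emb_def compose_def inj_on_def)
  moreover have "compose (univ A) g f \<in> univ A \<rightarrow>\<^sub>E univ C"
    using g fB by (auto simp: Emb_def compose_def)
  moreover have "xs \<in> rel A R \<longleftrightarrow> map (compose (univ A) g f) xs \<in> rel C R"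
    if R: "R \<in> symbols L" and xs: "xs \<in> tuples (arity L R) (univ A)" for R xs
  proof -
    have "map f xs \<in> tuples (arity L R) (univ B)"
      using xs fB by (auto simp: tuples_def)
    then have "xs \<in> rel A R \<longleftrightarrow> map g (map f xs) \<in> rel C R"
      using f g R xs by (simp add: Emb_def)
    also have "map g (map f xs) = map (compose (univ A) g f) xs"
      using xs by (auto simp: tuples_def compose_def)
    finally show ?thesis .
  qed
  ultimately show ?thesis
    by (simp add: Emb_def)
qed

lemma Aut_Emb: "g \<in> Aut L K \<Longrightarrow> g \<in> Emb L K K"
  by (simp add: Aut_def Iso_def)

lemma compose_Aut:
  assumes "g \<in> Aut L K" and "h \<in> Aut L K"
  shows "compose (univ K) g h \<in> Aut L K"
proof -
  have "g ` univ K = univ K" "h ` univ K = univ K"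
    using assms by (auto simp: Aut_def Iso_def)
  then have "compose (univ K) g h ` univ K = univ K"
    by (simp add: surj_compose)
  moreover have "compose (univ K) g h \<in> Emb L K K"
    using assms by (intro compose_Emb[of _ L K K]) (auto simp: Aut_Emb)
  ultimately show ?thesis
    by (simp add: Aut_def Iso_def)
qed

lemma restrict_id_Aut: "restrict id (univ K) \<in> Aut L K"
proof -
  have "map (restrict id (univ K)) xs = xs" if "xs \<in> tuples k (univ K)" for k xs
    using that by (intro map_idI) (auto simp: tuples_def)
  then show ?thesis
    by (auto simp: Aut_def Iso_def Emb_def inj_on_def)
qed

lemma compose_Aut_Emb: "\<lbrakk>g \<in> Aut L K; f \<in> Emb L A K\<rbrakk> \<Longrightarrow> compose (univ A) g f \<in> Emb L A K"
  by (rule compose_Emb[OF _ Aut_Emb])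

lemma compose_compose_Emb:
  "f \<in> Emb L A K \<Longrightarrow> compose (univ A) (compose (univ K) g h) f = compose (univ A) g (compose (univ A) h f)"
  by (auto simp: compose_def fun_eq_iff Emb_def PiE_iff)

lemma compose_id_Emb: "f \<in> Emb L A K \<Longrightarrow> compose (univ A) (restrict id (univ K)) f = f"
  by (auto simp: compose_def fun_eq_iff Emb_def PiE_iff extensional_def)

text \<open>The maps \<open>\<phi> \<mapsto> \<phi> \<cdot> g\<close> are closed under composition, as the Auslander--Ellis theorem
  requires, although the action is on the right: the order of the factors is reversed.\<close>

lemma act_act:
  assumes "h \<in> Aut L K"
  shows "act L K A (act L K A \<phi> g) h = act L K A \<phi> (compose (univ K) g h)"
  using assms by (auto simp: act_def fun_eq_iff compose_Aut_Emb compose_compose_Emb)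

lemma act_in_cantor_space: "act L K A \<phi> g \<in> Emb L A K \<rightarrow>\<^sub>E UNIV"
  by (simp add: act_def)

lemma continuous_map_act:
  assumes "g \<in> Aut L K"
  shows "continuous_map (cantor_space (Emb L A K)) (cantor_space (Emb L A K)) (\<lambda>\<phi>. act L K A \<phi> g)"
proof -
  have "continuous_map (cantor_space (Emb L A K)) (discrete_topology UNIV)
      (\<lambda>\<phi>. act L K A \<phi> g f)" if "f \<in> Emb L A K" for f
    using continuous_map_product_projection[of "compose (univ A) g f" "Emb L A K" "\<lambda>_. discrete_topology UNIV"]
      compose_Aut_Emb[OF assms that] that
    by (simp add: act_def cantor_space_def)
  then show ?thesis
    unfolding cantor_space_def continuous_map_componentwise
    by (auto simp: act_def)
qed

lemma act_chi:
  "\<lbrakk>g \<in> Aut L K; f \<in> Emb L A K\<rbrakk> \<Longrightarrow>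
     act L K A (chi (Emb L A K) P) g f \<longleftrightarrow> compose (univ A) g f \<in> P"
  by (simp add: act_def chi_apply compose_Aut_Emb)

lemma chi_in_orbit_closure_iff:
  "chi (Emb L A K) S \<in> orbit_closure L K A (chi (Emb L A K) P) \<longleftrightarrow>
    (\<forall>F. finite F \<and> F \<subseteq> Emb L A K \<longrightarrow>
      (\<exists>g\<in>Aut L K. \<forall>f\<in>F. compose (univ A) g f \<in> P \<longleftrightarrow> f \<in> S))"
proof -
  have "(\<exists>\<phi>\<in>act L K A (chi (Emb L A K) P) ` Aut L K. \<forall>f\<in>F. \<phi> f = chi (Emb L A K) S f) \<longleftrightarrow>
      (\<exists>g\<in>Aut L K. \<forall>f\<in>F. compose (univ A) g f \<in> P \<longleftrightarrow> f \<in> S)"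
    if "F \<subseteq> Emb L A K" for F
  proof -
    have "f \<in> Emb L A K" if "f \<in> F" for f
      using \<open>F \<subseteq> _\<close> that by blast
    then show ?thesis
      unfolding bex_simps by (intro bex_cong ball_cong refl) (simp add: act_chi chi_apply)
  qed
  moreover have "act L K A (chi (Emb L A K) P) ` Aut L K \<subseteq> Emb L A K \<rightarrow>\<^sub>E UNIV"
    using act_in_cantor_space by blast
  ultimately show ?thesis
    unfolding orbit_closure_def by (auto simp: in_cantor_closure_iff chi_in_cantor_space)
qed

lemma thick_iff:
  "thick L K A T \<longleftrightarrow> T \<subseteq> Emb L A K \<and>
    (\<forall>F. finite F \<and> F \<subseteq> Emb L A K \<longrightarrow> (\<exists>g\<in>Aut L K. \<forall>f\<in>F. compose (univ A) g f \<in> T))"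
proof -
  have "(\<forall>f\<in>F. compose (univ A) g f \<in> T \<longleftrightarrow> f \<in> Emb L A K) \<longleftrightarrow> (\<forall>f\<in>F. compose (univ A) g f \<in> T)"
    if "finite F \<and> F \<subseteq> Emb L A K" for F g
    using that by blast
  then show ?thesis
    unfolding thick_def chi_in_orbit_closure_iff by (simp cong: imp_cong)
qed

lemma syndetic_iff:
  "syndetic L K A S \<longleftrightarrow> S \<subseteq> Emb L A K \<and>
    (\<exists>F. finite F \<and> F \<subseteq> Emb L A K \<and> (\<forall>g\<in>Aut L K. \<exists>f\<in>F. compose (univ A) g f \<in> S))"
  unfolding syndetic_def chi_in_orbit_closure_iff by auto

lemma syndetic_mono:
  assumes "syndetic L K A S" and "S \<subseteq> S'" and "S' \<subseteq> Emb L A K"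
  shows "syndetic L K A S'"
proof -
  obtain F where "finite F" "F \<subseteq> Emb L A K" "\<forall>g\<in>Aut L K. \<exists>f\<in>F. compose (univ A) g f \<in> S"
    using assms(1) by (auto simp: syndetic_iff)
  moreover from this(3) have "\<forall>g\<in>Aut L K. \<exists>f\<in>F. compose (univ A) g f \<in> S'"
    using assms(2) by blast
  ultimately show ?thesis
    using assms(3) by (auto simp: syndetic_iff)
qed

text \<open>The finite set \<open>F\<close> that witnesses syndeticity of \<open>S\<close> also works for \<open>S'\<close>: on the finite
  set \<open>g F\<close>, \<open>S'\<close> looks like a translate \<open>S \<cdot> h\<close>, and \<open>S\<close> meets \<open>h g F\<close>.\<close>

lemma syndetic_in_orbit_closure:
  assumes S: "syndetic L K A S" and "S' \<subseteq> Emb L A K"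
    and S': "chi (Emb L A K) S' \<in> orbit_closure L K A (chi (Emb L A K) S)"
  shows "syndetic L K A S'"
proof -
  obtain F where F: "finite F" "F \<subseteq> Emb L A K" "\<forall>g\<in>Aut L K. \<exists>f\<in>F. compose (univ A) g f \<in> S"
    using S by (auto simp: syndetic_iff)
  have "\<exists>f\<in>F. compose (univ A) g f \<in> S'" if g: "g \<in> Aut L K" for g
  proof -
    have "compose (univ A) g ` F \<subseteq> Emb L A K"
      using F(2) g compose_Aut_Emb by blast
    then obtain h where h: "h \<in> Aut L K"
      "\<forall>f\<in>F. compose (univ A) h (compose (univ A) g f) \<in> S \<longleftrightarrow> compose (univ A) g f \<in> S'"
      using S' F(1) unfolding chi_in_orbit_closure_iff by (metis finite_imageI imageI)
    obtain f where f: "f \<in> F" "compose (univ A) (compose (univ K) h g) f \<in> S"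
      using F(3) compose_Aut[OF h(1) g] by blast
    then have "compose (univ A) h (compose (univ A) g f) \<in> S"
      using F(2) compose_compose_Emb[of f L A K h g] by auto
    with h(2) f(1) show ?thesis
      by blast
  qed
  with F(1,2) \<open>S' \<subseteq> _\<close> show ?thesis
    unfolding syndetic_iff by blast
qed

section \<open>Piecewise syndetic sets\<close>

text \<open>Proximality of \<open>P\<close> and \<open>S0\<close>, with \<open>S0\<close> taken in the orbit closure of \<open>S\<close> and therefore
  syndetic. The common limit is \<open>S0\<close> itself, but only the agreement of the translates of \<open>P\<close>
  and \<open>S0\<close> on finite sets is recorded.\<close>

lemma exists_proximal_syndetic:
  assumes "syndetic L K A S"
    and S: "chi (Emb L A K) S \<in> orbit_closure L K A (chi (Emb L A K) P)"
  obtains S0 where "syndetic L K A S0"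
    "\<And>F. \<lbrakk>finite F; F \<subseteq> Emb L A K\<rbrakk> \<Longrightarrow>
      \<exists>g\<in>Aut L K. \<forall>f\<in>F. compose (univ A) g f \<in> P \<longleftrightarrow> compose (univ A) g f \<in> S0"
proof -
  let ?H = "Emb L A K"
  let ?X = "cantor_space ?H"
  define \<G> where "\<G> = (\<lambda>g \<phi>. act L K A \<phi> g) ` Aut L K"
  define M where "M = orbit_closure L K A (chi ?H S)"
  have orbit: "(\<lambda>\<gamma>. \<gamma> \<phi>) ` \<G> = act L K A \<phi> ` Aut L K" for \<phi>
    by (simp add: \<G>_def image_image)
  obtain \<psi> where \<psi>: "\<psi> \<in> M"
    "\<And>U. \<lbrakk>openin ?X U; \<psi> \<in> U\<rbrakk> \<Longrightarrow> \<exists>\<gamma>\<in>\<G>. \<gamma> (chi ?H P) \<in> U \<and> \<gamma> \<psi> \<in> U"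
  proof (rule proximal_point_in_invariant_set[OF compact_cantor_space Hausdorff_cantor_space,
        where \<G> = \<G> and x = "chi ?H P" and M = M])
    show "continuous_map ?X ?X \<gamma>" if "\<gamma> \<in> \<G>" for \<gamma>
      using that continuous_map_act by (auto simp: \<G>_def)
    show "\<exists>\<kappa>\<in>\<G>. \<forall>\<phi>\<in>topspace ?X. \<kappa> \<phi> = \<gamma> (\<delta> \<phi>)" if "\<gamma> \<in> \<G>" "\<delta> \<in> \<G>" for \<gamma> \<delta>
      using that by (auto simp: \<G>_def act_act compose_Aut)
    show "chi ?H P \<in> topspace ?X"
      by (simp add: chi_in_cantor_space)
    show "closedin ?X M"
      by (simp add: M_def orbit_closure_def)
    show "\<gamma> \<phi> \<in> M" if \<gamma>: "\<gamma> \<in> \<G>" and "\<phi> \<in> M" for \<gamma> \<phi>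
    proof -
      obtain g where g: "g \<in> Aut L K" "\<gamma> = (\<lambda>\<phi>. act L K A \<phi> g)"
        using \<gamma> by (auto simp: \<G>_def)
      have "\<gamma> \<phi> \<in> ?X closure_of (\<gamma> ` act L K A (chi ?H S) ` Aut L K)"
        using continuous_map_image_closure_subset[OF continuous_map_act[OF g(1)]] g(2) \<open>\<phi> \<in> M\<close>
        unfolding M_def orbit_closure_def by blast
      also have "\<dots> \<subseteq> M"
        unfolding M_def orbit_closure_def using g by (intro closure_of_mono) (auto simp: act_act compose_Aut)
      finally show ?thesis .
    qed
    have "chi ?H S \<in> M"
      unfolding M_def chi_in_orbit_closure_iff
      using restrict_id_Aut by (metis compose_id_Emb subsetD)
    then show "M \<inter> ?X closure_of (\<lambda>\<gamma>. \<gamma> (chi ?H P)) ` \<G> \<noteq> {}"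
      using S unfolding orbit orbit_closure_def by blast
  qed (rule that)
  define S0 where "S0 = {f \<in> ?H. \<psi> f}"
  have "\<psi> \<in> ?H \<rightarrow>\<^sub>E UNIV"
    using \<psi>(1) by (simp add: M_def orbit_closure_def in_closure_of)
  then have chi_S0: "chi ?H S0 = \<psi>"
    by (simp add: S0_def chi_Collect)
  show ?thesis
  proof (rule that)
    show "syndetic L K A S0"
    proof (rule syndetic_in_orbit_closure[OF assms(1)])
      show "S0 \<subseteq> ?H"
        by (auto simp: S0_def)
      show "chi ?H S0 \<in> orbit_closure L K A (chi ?H S)"
        using \<psi>(1) by (simp add: chi_S0 M_def)
    qed
    fix F assume F: "finite F" "F \<subseteq> ?H"
    let ?U = "{\<phi> \<in> ?H \<rightarrow>\<^sub>E UNIV. \<forall>f\<in>F. \<phi> f = \<psi> f}"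
    have "\<psi> \<in> ?U"
      using \<open>\<psi> \<in> ?H \<rightarrow>\<^sub>E UNIV\<close> by simp
    then have "\<exists>\<gamma>\<in>\<G>. \<gamma> (chi ?H P) \<in> ?U \<and> \<gamma> \<psi> \<in> ?U"
      by (rule \<psi>(2)[OF openin_cantor_cylinder[OF F]])
    then obtain g where g: "g \<in> Aut L K"
      "act L K A (chi ?H P) g \<in> ?U" "act L K A (chi ?H S0) g \<in> ?U"
      unfolding \<G>_def chi_S0 bex_simps by (elim bexE conjE)
    have "compose (univ A) g f \<in> P \<longleftrightarrow> compose (univ A) g f \<in> S0" if "f \<in> F" for f
    proof -
      have "f \<in> ?H"
        using that F(2) by blast
      moreover have "act L K A (chi ?H P) g f = act L K A (chi ?H S0) g f"
        using g(2,3) that by simp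
      ultimately show ?thesis
        by (simp add: act_chi g(1))
    qed
    with g(1) show "\<exists>g\<in>Aut L K. \<forall>f\<in>F. compose (univ A) g f \<in> P \<longleftrightarrow> compose (univ A) g f \<in> S0"
      by blast
  qed
qed

text \<open>Where a translate of \<open>F\<close> sees no difference between \<open>P\<close> and \<open>S0\<close>, each of its points
  lies in \<open>P\<close> or outside \<open>S0\<close>; this makes \<open>P \<union> (H - S0)\<close> thick.\<close>

lemma piecewise_syndetic_imp_Int:
  assumes "piecewise_syndetic L K A P"
  obtains T S where "thick L K A T" "syndetic L K A S" "P = S \<inter> T"
proof -
  let ?H = "Emb L A K"
  obtain S where "P \<subseteq> ?H" and S: "syndetic L K A S" "chi ?H S \<in> orbit_closure L K A (chi ?H P)"
    using assms by (auto simp: piecewise_syndetic_def)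
  obtain S0 where S0: "syndetic L K A S0"
    "\<And>F. \<lbrakk>finite F; F \<subseteq> ?H\<rbrakk> \<Longrightarrow>
      \<exists>g\<in>Aut L K. \<forall>f\<in>F. compose (univ A) g f \<in> P \<longleftrightarrow> compose (univ A) g f \<in> S0"
    using exists_proximal_syndetic[OF S] by metis
  have "S0 \<subseteq> ?H"
    using S0(1) by (simp add: syndetic_def)
  show ?thesis
  proof (rule that)
    show "thick L K A (P \<union> (?H - S0))"
      unfolding thick_iff
    proof (intro conjI allI impI)
      fix F assume F: "finite F \<and> F \<subseteq> ?H"
      then obtain g where g: "g \<in> Aut L K"
        "\<forall>f\<in>F. compose (univ A) g f \<in> P \<longleftrightarrow> compose (univ A) g f \<in> S0"
        using S0(2) by blast
      then have "\<forall>f\<in>F. compose (univ A) g f \<in> P \<union> (?H - S0)"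
        using F compose_Aut_Emb[OF g(1)] by blast
      with g(1) show "\<exists>g\<in>Aut L K. \<forall>f\<in>F. compose (univ A) g f \<in> P \<union> (?H - S0)"
        by blast
    qed (use \<open>P \<subseteq> ?H\<close> in auto)
    show "syndetic L K A (P \<union> S0)"
      using S0(1) by (rule syndetic_mono) (use \<open>P \<subseteq> ?H\<close> \<open>S0 \<subseteq> ?H\<close> in auto)
  qed auto
qed

text \<open>The closures of the sets \<open>N F\<close> of translates \<open>S \<cdot> g\<close> with \<open>g F \<subseteq> T\<close> have the finite
  intersection property, because \<open>N\<close> is antitone and \<open>T\<close> is thick. Any common point \<open>S'\<close> is a
  limit of \<open>S \<cdot> g\<close> along \<open>g\<close> for which \<open>T \<cdot> g\<close> tends to the full set, so intersecting with
  \<open>T\<close> does not change the limit.\<close>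

lemma thick_cluster_set:
  assumes "thick L K A T"
  obtains S' where "S' \<subseteq> Emb L A K"
    "chi (Emb L A K) S' \<in> orbit_closure L K A (chi (Emb L A K) S)"
    "chi (Emb L A K) S' \<in> orbit_closure L K A (chi (Emb L A K) (S \<inter> T))"
proof -
  let ?H = "Emb L A K"
  define N where "N F = act L K A (chi ?H S) ` {g \<in> Aut L K. \<forall>f\<in>F. compose (univ A) g f \<in> T}" for F
  define \<C> where "\<C> = (\<lambda>F. cantor_space ?H closure_of N F) ` {F. finite F \<and> F \<subseteq> ?H}"
  have N_top: "N F \<subseteq> ?H \<rightarrow>\<^sub>E UNIV" for F
    unfolding N_def by (intro image_subsetI act_in_cantor_space)
  have fip: "\<Inter>\<D> \<noteq> {}" if \<D>: "finite \<D>" "\<D> \<subseteq> \<C>" for \<D>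
  proof -
    obtain \<F> where \<F>: "finite \<F>" "\<F> \<subseteq> {F. finite F \<and> F \<subseteq> ?H}"
      "\<D> = (\<lambda>F. cantor_space ?H closure_of N F) ` \<F>"
      using finite_subset_image[OF \<D>[unfolded \<C>_def]] by (elim exE conjE)
    then have "finite (\<Union>\<F>) \<and> \<Union>\<F> \<subseteq> ?H"
      by auto
    then obtain g where g: "g \<in> Aut L K" "\<forall>f\<in>\<Union>\<F>. compose (univ A) g f \<in> T"
      using assms unfolding thick_iff by meson
    have "act L K A (chi ?H S) g \<in> cantor_space ?H closure_of N F" if "F \<in> \<F>" for F
    proof -
      have "act L K A (chi ?H S) g \<in> N F"
        using g that by (auto simp: N_def)
      then show ?thesis
        using closure_of_subset[of "N F" "cantor_space ?H"] N_top[of F]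
        unfolding topspace_cantor_space by (meson subsetD)
    qed
    then show ?thesis
      unfolding \<F>(3) by blast
  qed
  have "closedin (cantor_space ?H) C" if "C \<in> \<C>" for C
    using that by (auto simp: \<C>_def)
  with compact_cantor_space have "\<Inter>\<C> \<noteq> {}"
    using fip by (rule compact_space_Inter_nonempty)
  then obtain \<psi> where \<psi>: "\<And>F. \<lbrakk>finite F; F \<subseteq> ?H\<rbrakk> \<Longrightarrow> \<psi> \<in> cantor_space ?H closure_of N F"
    by (auto simp: \<C>_def)
  define S' where "S' = {f \<in> ?H. \<psi> f}"
  have approx: "\<exists>g\<in>Aut L K. \<forall>f\<in>F. compose (univ A) g f \<in> T \<and> (compose (univ A) g f \<in> S \<longleftrightarrow> f \<in> S')"
    if F: "finite F" "F \<subseteq> ?H" for F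
  proof -
    obtain \<phi> where \<phi>: "\<phi> \<in> N F" "\<forall>f\<in>F. \<phi> f = \<psi> f"
      using \<psi>[OF F] F unfolding in_cantor_closure_iff[OF N_top] by meson
    then obtain g where g: "g \<in> Aut L K" "\<forall>f\<in>F. compose (univ A) g f \<in> T"
      "\<phi> = act L K A (chi ?H S) g"
      by (auto simp: N_def)
    have "compose (univ A) g f \<in> S \<longleftrightarrow> f \<in> S'" if "f \<in> F" for f
    proof -
      have "f \<in> ?H"
        using that F(2) by blast
      moreover have "act L K A (chi ?H S) g f \<longleftrightarrow> \<psi> f"
        using \<phi>(2) that by (simp add: g(3))
      ultimately show ?thesis
        using act_chi[OF g(1), of f A S] by (simp add: S'_def)
    qed
    with g(1,2) show ?thesis
      by blast
  qed
  show ?thesis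
  proof (rule that)
    show "S' \<subseteq> ?H"
      by (auto simp: S'_def)
    show "chi ?H S' \<in> orbit_closure L K A (chi ?H S)"
      unfolding chi_in_orbit_closure_iff
    proof (intro allI impI, elim conjE)
      fix F assume "finite F" "F \<subseteq> ?H"
      from approx[OF this] show "\<exists>g\<in>Aut L K. \<forall>f\<in>F. compose (univ A) g f \<in> S \<longleftrightarrow> f \<in> S'"
        by (elim bexE) (rule bexI, auto)
    qed
    show "chi ?H S' \<in> orbit_closure L K A (chi ?H (S \<inter> T))"
      unfolding chi_in_orbit_closure_iff
    proof (intro allI impI, elim conjE)
      fix F assume "finite F" "F \<subseteq> ?H"
      from approx[OF this] show "\<exists>g\<in>Aut L K. \<forall>f\<in>F. compose (univ A) g f \<in> S \<inter> T \<longleftrightarrow> f \<in> S'"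
        by (elim bexE) (rule bexI, auto)
    qed
  qed
qed

lemma thick_Int_syndetic_imp_piecewise_syndetic:
  assumes "thick L K A T" and "syndetic L K A S"
  shows "piecewise_syndetic L K A (S \<inter> T)"
proof -
  obtain S' where S': "S' \<subseteq> Emb L A K"
    "chi (Emb L A K) S' \<in> orbit_closure L K A (chi (Emb L A K) S)"
    "chi (Emb L A K) S' \<in> orbit_closure L K A (chi (Emb L A K) (S \<inter> T))"
    using thick_cluster_set[OF assms(1)] by metis
  have "syndetic L K A S'"
    using assms(2) S'(1,2) by (rule syndetic_in_orbit_closure)
  moreover have "S \<inter> T \<subseteq> Emb L A K"
    using assms(1) by (auto simp: thick_def)
  ultimately show ?thesis
    using S'(3) unfolding piecewise_syndetic_def by auto
qed

theorem theorem4p3: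
  fixes L :: "'r language" and K :: "('r, 'a) struct"
    and A :: "nat \<Rightarrow> ('r, 'a) struct" and m :: nat and P :: "('a \<Rightarrow> 'a) set"
  assumes "fraisse_structure L K"
    and "exhaustion L K A"
    and "P \<subseteq> Emb L (A m) K"
  shows "piecewise_syndetic L K (A m) P \<longleftrightarrow>
    (\<exists>T S. thick L K (A m) T \<and> syndetic L K (A m) S \<and> P = S \<inter> T)"
proof
  assume "piecewise_syndetic L K (A m) P"
  then obtain T S where "thick L K (A m) T" "syndetic L K (A m) S" "P = S \<inter> T"
    by (rule piecewise_syndetic_imp_Int)
  then show "\<exists>T S. thick L K (A m) T \<and> syndetic L K (A m) S \<and> P = S \<inter> T"
    by (intro exI conjI)
next
  assume "\<exists>T S. thick L K (A m) T \<and> syndetic L K (A m) S \<and> P = S \<inter> T"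
  then show "piecewise_syndetic L K (A m) P"
    using thick_Int_syndetic_imp_piecewise_syndetic by (elim exE conjE) simp
qed

end
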